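(* Let $f:\mathbb{D}\to\mathbb{C}$ be analytic with $\mathbb{A}_E(f(\mathbb{D}))<\infty$. For any $\theta\in\mathbb{R}$, let $L_E(\rho_0)$ denote the Euclidean length of the image under $f$ of the radial segment $[0,r_0e^{i\theta}]$, where $r_0=\tanh\frac{1}{2}\rho_0$ (so the segment has hyperbolic length $\rho_0$), i.e. $L_E(\rho_0)=\int_0^{\rho_0}\|f'(\gamma(t))\|_{H\to E}\,dt$ with $\gamma(t)=\tanh(\frac{t}{2})e^{i\theta}$. Then $$L_E(\rho_0)=o(\rho_0^{1/2})\quad\text{as }\rho_0\to\infty.$$
   Context: $\mathbb{D}=\{|z|<1\}$ carries the hyperbolic metric with density $\lambda_H(z)=2/(1-|z|^2)$; $\mathbb{C}$ carries the Euclidean metric. $\|f'(z)\|_{H\to E}=|f'(z)|/\lambda_H(z)$. $\mathbb{A}_E(f(\mathbb{D}))=\int_{\mathbb{D}}|f'(z)|^2\,dx\,dy$ is the Euclidean area of the image counting multiplicity. *)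

theory Defs
  imports "HOL-Analysis.Analysis" "HOL-Library.Landau_Symbols"
begin

definition hyp_density :: "complex \<Rightarrow> real" where
  "hyp_density z = 2 / (1 - (cmod z)\<^sup>2)"

definition norm_HE :: "(complex \<Rightarrow> complex) \<Rightarrow> complex \<Rightarrow> real" where
  "norm_HE f z = cmod (deriv f z) / hyp_density z"

text \<open>Finite Euclidean area (with multiplicity) of f(D): |f'|^2 integrable over D.\<close>
definition finite_euclid_area :: "(complex \<Rightarrow> complex) \<Rightarrow> bool" where
  "finite_euclid_area f \<longleftrightarrow> (\<lambda>z. (cmod (deriv f z))\<^sup>2) integrable_on ball 0 1"

definition radial_geod :: "real \<Rightarrow> real \<Rightarrow> complex" where
  "radial_geod \<theta> t = complex_of_real (tanh (t / 2)) * cis \<theta>"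

definition L_E :: "(complex \<Rightarrow> complex) \<Rightarrow> real \<Rightarrow> real \<Rightarrow> real" where
  "L_E f \<theta> \<rho>0 = integral {0..\<rho>0} (\<lambda>t. norm_HE f (radial_geod \<theta> t))"

end

theory Submission
  imports Defs "HOL-Complex_Analysis.Cauchy_Integral_Formula"
begin

text \<open>
  Write f(z) = sum a(n) z^n. Orthogonality of the monomials on discs turns the finite area into
  summability of n |a(n)|^2. The radial length is at most sum |a(n)| r^n with r = tanh (rho / 2),
  the integral of the majorant of |f'|. Splitting this sum at N and applying Cauchy-Schwarz to the
  tail gives the bound O(1) + sqrt (sum over n >= N of n |a(n)|^2) * sqrt (- ln (1 - r^2)), and
  - ln (1 - r^2) <= rho.
\<close>

section \<open>Rotation invariance of Lebesgue measure\<close>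

text \<open>
  As for uniqueness of Haar measure: with A the unit ball, evaluate the double integral of
  1_A(x) 1_B(T y + x) in both orders, using translation invariance and T-invariance of A.
\<close>

lemma distr_lborel_orthogonal_transformation:
  fixes T :: "'a::euclidean_space \<Rightarrow> 'a"
  assumes T: "orthogonal_transformation T"
  shows "distr lborel borel T = lborel"
proof (rule measure_eqI)
  let ?A = "ball 0 1 :: 'a set"
  have lin: "linear T" using T by (rule orthogonal_transformation_linear)
  have [measurable]: "T \<in> borel_measurable borel"
    using lin by (intro borel_measurable_continuous_onI linear_continuous_on linear_conv_bounded_linear[THEN iffD1])
  obtain S where S: "\<And>x. T (S x) = x" 
    using orthogonal_transformation_surj[OF T] by (metis surjD)
  fix B assume "B \<in> sets (distr lborel borel T)"
  hence [measurable]: "B \<in> sets borel" by simp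
  have [measurable]: "?A \<in> sets borel" by simp
  have [measurable]: "(\<lambda>p. T (fst p) + snd p) \<in> borel_measurable (borel \<Otimes>\<^sub>M borel)"
    "(\<lambda>p. T (snd p) + fst p) \<in> borel_measurable (borel \<Otimes>\<^sub>M borel)"
    by measurable
  have shift: "(\<integral>\<^sup>+x. f (x + c) \<partial>lborel) = (\<integral>\<^sup>+x. f x \<partial>lborel)"
    if [measurable]: "f \<in> borel_measurable borel" for f :: "'a \<Rightarrow> ennreal" and c
  proof -
    have "(\<integral>\<^sup>+x. f (c + x) \<partial>lborel) = (\<integral>\<^sup>+x. f x \<partial>distr lborel borel ((+) c))"
      by (subst nn_integral_distr) auto
    thus ?thesis by (simp add: lborel_distr_plus add.commute)
  qed
  have "emeasure lborel ?A * emeasure lborel (T -` B)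
      = (\<integral>\<^sup>+x. indicator ?A x * (\<integral>\<^sup>+y. indicator B (T y) \<partial>lborel) \<partial>lborel)"
  proof -
    have "(\<integral>\<^sup>+y. indicator B (T y) \<partial>lborel) = (\<integral>\<^sup>+y. indicator (T -` B) y \<partial>lborel)"
      by (intro nn_integral_cong) (auto simp: indicator_def)
    also have "\<dots> = emeasure lborel (T -` B)"
      using measurable_sets[of T borel borel B] by (simp add: nn_integral_indicator)
    moreover have "(\<integral>\<^sup>+x. indicator ?A x * emeasure lborel (T -` B) \<partial>lborel) = emeasure lborel ?A * emeasure lborel (T -` B)"
      by (subst nn_integral_multc) (auto intro!: borel_measurable_indicator)
    ultimately show ?thesis by simp
  qed
  also have "\<dots> = (\<integral>\<^sup>+x. \<integral>\<^sup>+y. indicator ?A x * indicator B (T y + x) \<partial>lborel \<partial>lborel)"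
  proof (rule nn_integral_cong)
    fix x
    \<comment> \<open>Since \<open>x = T (S x)\<close>, a translation by \<open>x\<close> after
      \<open>T\<close> is a translation by \<open>S x\<close> before it, which the integral over
      \<open>y\<close> absorbs.\<close>
    have "(\<integral>\<^sup>+y. indicator B (T y + x) \<partial>lborel) = (\<integral>\<^sup>+y. indicator B (T (y + S x)) \<partial>lborel)"
      by (simp add: linear_add[OF lin] S)
    also have "\<dots> = (\<integral>\<^sup>+y. indicator B (T y) \<partial>lborel)"
      by (rule shift) measurable
    finally show "indicator ?A x * (\<integral>\<^sup>+y. indicator B (T y) \<partial>lborel) =
        (\<integral>\<^sup>+y. indicator ?A x * indicator B (T y + x) \<partial>lborel)"
      by (simp add: nn_integral_cmult)
  qed
  also have "\<dots> = (\<integral>\<^sup>+y. \<integral>\<^sup>+x. indicator ?A x * indicator B (T y + x) \<partial>lborel \<partial>lborel)"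
    by (rule lborel_pair.Fubini') measurable
  also have "\<dots> = (\<integral>\<^sup>+y. \<integral>\<^sup>+x. indicator ?A (x - T y) * indicator B x \<partial>lborel \<partial>lborel)"
  proof (rule nn_integral_cong)
    fix y
    have "(\<integral>\<^sup>+x. indicator ?A x * indicator B (T y + x) \<partial>lborel)
       = (\<integral>\<^sup>+x. indicator ?A ((x + T y) - T y) * indicator B (x + T y) \<partial>lborel)"
      by (simp add: add.commute)
    also have "\<dots> = (\<integral>\<^sup>+x. indicator ?A (x - T y) * indicator B x \<partial>lborel)"
      by (rule shift) measurable
    finally show "(\<integral>\<^sup>+x. indicator ?A x * indicator B (T y + x) \<partial>lborel) =
        (\<integral>\<^sup>+x. indicator ?A (x - T y) * indicator B x \<partial>lborel)" .
  qed
  also have "\<dots> = (\<integral>\<^sup>+x. \<integral>\<^sup>+y. indicator ?A (x - T y) * indicator B x \<partial>lborel \<partial>lborel)"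
    by (rule lborel_pair.Fubini') measurable
  also have "\<dots> = (\<integral>\<^sup>+x. emeasure lborel ?A * indicator B x \<partial>lborel)"
  proof (rule nn_integral_cong)
    fix x
    have "norm (T y - x) = norm (S x - y)" for y
      using orthogonal_transformation_norm[OF T, of "S x - y"]
      by (simp add: linear_diff[OF lin] S norm_minus_commute)
    hence "(\<integral>\<^sup>+y. indicator ?A (x - T y) \<partial>lborel) = (\<integral>\<^sup>+y. indicator (ball (S x) 1) y \<partial>lborel)"
      by (intro nn_integral_cong) (auto simp: indicator_def dist_norm)
    also have "\<dots> = emeasure lborel ?A"
      by (simp add: emeasure_ball)
    finally show "(\<integral>\<^sup>+y. indicator ?A (x - T y) * indicator B x \<partial>lborel) = emeasure lborel ?A * indicator B x"
      by (simp add: nn_integral_multc)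
  qed
  also have "\<dots> = emeasure lborel ?A * emeasure lborel B"
    by (simp add: nn_integral_cmult)
  \<comment> \<open>The factor \<open>emeasure lborel ?A\<close> cancels because the unit ball has
    positive and finite volume.\<close>
  finally show "emeasure (distr lborel borel T) B = emeasure lborel B"
    using less_imp_neq[OF unit_ball_vol_pos[OF of_nat_0_le_iff], of "DIM('a)"]
    by (auto simp: emeasure_distr emeasure_ball ennreal_mult_cancel_left)
qed simp

section \<open>Orthogonality of monomials on discs\<close>

text \<open>The disc is invariant under rotations, so an integrand that some rotation negates has
  integral equal to its own negative. The indicator in \<open>g\<close> turns the integral into one
  over the whole plane, where invariance of the measure applies directly.\<close>

lemma has_integral_cball_distinct_monomials:
  assumes "j \<noteq> k"
  shows "((\<lambda>z::complex. z ^ j * cnj z ^ k) has_integral 0) (cball 0 R)"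
proof -
  define g where "g z = indicator (cball 0 R) z *\<^sub>R (z ^ j * cnj z ^ k)" for z :: complex
  have g_int: "integrable lborel g"
    unfolding g_def by (intro borel_integrable_compact continuous_intros) auto
  \<comment> \<open>Rotation by \<open>u\<close> changes the sign of the integrand.\<close>
  define u where "u = cis (pi / (real j - real k))"
  have u: "cmod u = 1" by (simp add: u_def)
  have "u ^ j * cnj u ^ k = cis (real j * (pi / (real j - real k)) - real k * (pi / (real j - real k)))"
    by (simp add: u_def Complex.DeMoivre cis_mult cis_cnj)
  also have "real j * (pi / (real j - real k)) - real k * (pi / (real j - real k)) = (real j - real k) * (pi / (real j - real k))"
    by (simp only: left_diff_distrib)
  also have "\<dots> = pi" using assms by simp
  finally have uu: "u ^ j * cnj u ^ k = -1" by simp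
  have gu: "g (u * z) = - g z" for z
  proof -
    have "(u * z) ^ j * cnj (u * z) ^ k = (u ^ j * cnj u ^ k) * (z ^ j * cnj z ^ k)"
      by (simp add: power_mult_distrib mult_ac)
    thus ?thesis by (simp add: g_def uu norm_mult u indicator_def)
  qed
  have "orthogonal_transformation ((*) u)"
    by (auto simp: orthogonal_transformation norm_mult u intro: linearI algebra_simps)
  hence "integral\<^sup>L lborel g = integral\<^sup>L (distr lborel borel ((*) u)) g"
    by (simp add: distr_lborel_orthogonal_transformation)
  also have "\<dots> = (LINT z|lborel. g (u * z))"
    using g_int by (intro integral_distr) auto
  also have "\<dots> = - integral\<^sup>L lborel g"
    by (simp add: gu)
  finally have "integral\<^sup>L lborel g = 0" by simp
  moreover have "set_integrable lborel (cball 0 R) (\<lambda>z::complex. z ^ j * cnj z ^ k)"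
    using g_int unfolding set_integrable_def g_def[abs_def] .
  ultimately show ?thesis
    using set_borel_integral_eq_integral[of "cball 0 R" "\<lambda>z::complex. z ^ j * cnj z ^ k"]
    by (simp add: set_lebesgue_integral_def g_def[abs_def] has_integral_iff)
qed

text \<open>Parseval on a disc: the squared modulus expands into a double sum of
  \<open>z ^ j * cnj z ^ k\<close>, whose off-diagonal terms integrate to zero. The moments stay
  unevaluated, since only lower bounds for them are used later.\<close>

lemma has_integral_cball_cmod_poly_squared:
  fixes b :: "nat \<Rightarrow> complex"
  shows "((\<lambda>z. (cmod (\<Sum>k<K. b k * z ^ k))\<^sup>2) has_integral
    (\<Sum>k<K. (cmod (b k))\<^sup>2 * integral (cball 0 R) (\<lambda>z::complex. cmod z ^ (2 * k)))) (cball 0 R)"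
proof -
  define c where "c k = integral (cball 0 R) (\<lambda>z::complex. cmod z ^ (2 * k))" for k
  have mono: "((\<lambda>z::complex. z ^ j * cnj z ^ k) has_integral (if k = j then of_real (c k) else 0)) (cball 0 R)"
    for j k
  proof (cases "k = j")
    case True
    have "set_integrable lborel (cball 0 R) (\<lambda>z::complex. cmod z ^ (2 * k))"
      unfolding set_integrable_def by (intro borel_integrable_compact continuous_intros) auto
    hence "((\<lambda>z::complex. cmod z ^ (2 * k)) has_integral c k) (cball 0 R)"
      unfolding c_def by (intro integrable_integral set_borel_integral_eq_integral)
    hence "((\<lambda>z::complex. complex_of_real (cmod z ^ (2 * k))) has_integral of_real (c k)) (cball 0 R)"
      by (rule has_integral_of_real)
    moreover have "complex_of_real (cmod z ^ (2 * k)) = z ^ j * cnj z ^ k" for z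
    proof -
      have "complex_of_real (cmod z ^ (2 * k)) = of_real ((cmod z)\<^sup>2) ^ k"
        by (simp add: power_mult)
      thus ?thesis
        using True by (simp only: complex_norm_square power_mult_distrib)
    qed
    ultimately show ?thesis using True by simp
  qed (use has_integral_cball_distinct_monomials[of j k R] in auto)
  have "((\<lambda>z. \<Sum>j<K. \<Sum>k<K. (b j * cnj (b k)) * (z ^ j * cnj z ^ k)) has_integral
     (\<Sum>j<K. \<Sum>k<K. (b j * cnj (b k)) * (if k = j then of_real (c k) else 0))) (cball 0 R)"
    by (intro has_integral_sum has_integral_mult_right mono) auto
  hence "((\<lambda>z. Re (\<Sum>j<K. \<Sum>k<K. (b j * cnj (b k)) * (z ^ j * cnj z ^ k))) has_integral
     Re (\<Sum>j<K. \<Sum>k<K. (b j * cnj (b k)) * (if k = j then of_real (c k) else 0))) (cball 0 R)"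
    by (rule has_integral_linear[OF _ bounded_linear_Re, unfolded o_def])
  moreover have "Re (\<Sum>j<K. \<Sum>k<K. (b j * cnj (b k)) * (z ^ j * cnj z ^ k)) = (cmod (\<Sum>k<K. b k * z ^ k))\<^sup>2" for z
  proof -
    have "complex_of_real ((cmod (\<Sum>k<K. b k * z ^ k))\<^sup>2) = (\<Sum>j<K. \<Sum>k<K. (b j * cnj (b k)) * (z ^ j * cnj z ^ k))"
      by (simp only: complex_norm_square) (simp add: sum_product mult_ac)
    thus ?thesis by (metis Re_complex_of_real)
  qed
  moreover have "Re (\<Sum>j<K. \<Sum>k<K. (b j * cnj (b k)) * (if k = j then of_real (c k) else 0)) = (\<Sum>k<K. (cmod (b k))\<^sup>2 * c k)"
    by (simp add: if_distrib cong: if_cong) (simp only: cmod_power2, simp add: power2_eq_square)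
  ultimately show ?thesis by (simp add: c_def)
qed

section \<open>From finite area to summable coefficients\<close>

text \<open>For \<open>s \<le> R\<close> the integrand is at least \<open>s ^ m\<close> on the
  annulus between the radii \<open>s\<close> and \<open>R\<close>, whose area is the second factor.
  For \<open>s > R\<close> the left side is nonpositive; admitting this case lets the bound be
  applied to all radii \<open>s k\<close> at once for a fixed \<open>R\<close>.\<close>

lemma integral_cball_cmod_power_ge:
  assumes "0 \<le> R" "0 \<le> s"
  shows "s ^ m * (pi * (R\<^sup>2 - s\<^sup>2)) \<le> integral (cball 0 R) (\<lambda>z::complex. cmod z ^ m)"
proof -
  have int: "(\<lambda>z::complex. cmod z ^ m) integrable_on cball 0 R"
  proof -
    have "set_integrable lborel (cball 0 R) (\<lambda>z::complex. cmod z ^ m)"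
      unfolding set_integrable_def by (intro borel_integrable_compact continuous_intros) auto
    thus ?thesis by (rule set_borel_integral_eq_integral)
  qed
  show ?thesis
  proof (cases "s \<le> R")
    case True
    define D where "D = cball (0::complex) R - ball 0 s"
    have [measurable]: "D \<in> sets borel" by (auto simp: D_def)
    have cD: "compact D" unfolding D_def by (intro compact_diff) auto
    have "measure lborel D = measure lborel (cball (0::complex) R) - measure lborel (ball (0::complex) s)"
      unfolding D_def using True emeasure_lborel_cball_finite[of "0::complex" R]
      by (intro measure_Diff) auto
    also have "\<dots> = pi * (R\<^sup>2 - s\<^sup>2)"
      using assms by (simp add: content_cball content_ball eval_unit_ball_vol algebra_simps)
    finally have mD: "measure lborel D = pi * (R\<^sup>2 - s\<^sup>2)" .
    have D1: "((\<lambda>z. s ^ m * 1) has_integral s ^ m * (pi * (R\<^sup>2 - s\<^sup>2))) D"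
      unfolding mD[symmetric]
      by (intro has_integral_mult_right has_integral_measure_lborel emeasure_compact_finite cD) auto
    have D2: "(\<lambda>z::complex. cmod z ^ m) integrable_on D"
    proof -
      have "set_integrable lborel D (\<lambda>z::complex. cmod z ^ m)"
        unfolding set_integrable_def by (intro borel_integrable_compact continuous_intros cD)
      thus ?thesis by (rule set_borel_integral_eq_integral)
    qed
    have "s ^ m * (pi * (R\<^sup>2 - s\<^sup>2)) \<le> integral D (\<lambda>z::complex. cmod z ^ m)"
      using D2 assms by (intro has_integral_le[OF D1 integrable_integral]) (auto simp: D_def intro: power_mono)
    also have "\<dots> \<le> integral (cball 0 R) (\<lambda>z::complex. cmod z ^ m)"
      by (intro integral_subset_le D2 int) (auto simp: D_def)
    finally show ?thesis .
  next
    case False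
    hence "R\<^sup>2 \<le> s\<^sup>2" using assms by (intro power_mono) auto
    hence "s ^ m * (pi * (R\<^sup>2 - s\<^sup>2)) \<le> 0"
      using assms by (intro mult_nonneg_nonpos) auto
    also have "0 \<le> integral (cball 0 R) (\<lambda>z::complex. cmod z ^ m)"
      by (intro integral_nonneg int) auto
    finally show ?thesis .
  qed
qed

text \<open>Raise \<open>1 + 1 / k \<le> exp (1 / k)\<close> to the power \<open>- 2 * k\<close>. At
  \<open>k = 0\<close> the right side is \<open>0 ^ 0 = 1\<close>.\<close>

lemma exp_minus2_le_power: "exp (-2) \<le> (real k / real (Suc k)) ^ (2 * k)"
proof (cases "k = 0")
  case False
  have "1 + 1 / real k \<le> exp (1 / real k)" by (rule exp_ge_add_one_self)
  hence "exp (- (1 / real k)) \<le> real k / real (Suc k)"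
    using False by (simp add: exp_minus field_simps)
  hence "exp (- (1 / real k)) ^ (2 * k) \<le> (real k / real (Suc k)) ^ (2 * k)"
    by (intro power_mono) auto
  also have "exp (- (1 / real k)) ^ (2 * k) = exp (-2)"
    using False by (simp flip: exp_of_nat_mult)
  finally show ?thesis .
qed simp

text \<open>A Bessel inequality. On a disc of radius \<open>R < 1\<close> the partial sums of the
  power series are uniformly bounded, so Parseval for polynomials passes to \<open>h\<close> by
  dominated convergence; enlarging the disc to \<open>ball 0 1\<close> only increases the
  integral.\<close>

lemma sum_cmod_coeffs_squared_le_integral:
  fixes b :: "nat \<Rightarrow> complex"
  assumes sums: "\<And>z. cmod z < 1 \<Longrightarrow> (\<lambda>n. b n * z ^ n) sums h z"
    and int: "(\<lambda>z. (cmod (h z))\<^sup>2) integrable_on ball 0 1"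
    and R: "0 \<le> R" "R < 1"
  shows "(\<Sum>k<K. (cmod (b k))\<^sup>2 * integral (cball 0 R) (\<lambda>z::complex. cmod z ^ (2 * k)))
           \<le> integral (ball 0 1) (\<lambda>z. (cmod (h z))\<^sup>2)"
proof -
  define c where "c k = integral (cball 0 R) (\<lambda>z::complex. cmod z ^ (2 * k))" for k
  define p where "p N z = (cmod (\<Sum>k<N. b k * z ^ k))\<^sup>2" for N z
  have p_int: "(p N has_integral (\<Sum>k<N. (cmod (b k))\<^sup>2 * c k)) (cball 0 R)" for N
    unfolding p_def[abs_def] c_def by (rule has_integral_cball_cmod_poly_squared)
  \<comment> \<open>At \<open>s = R\<close> the annulus degenerates and the lower bound for the
    moment is 0.\<close>
  have c_nonneg: "0 \<le> c k" for k
    using integral_cball_cmod_power_ge[of R 0 "2 * k"] integral_cball_cmod_power_ge[of R R "2 * k"] R by (simp add: c_def)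
  \<comment> \<open>Convergence at a point of larger modulus \<open>r\<close> gives absolute
    convergence at \<open>R\<close>, hence the common bound \<open>M\<close> for all partial sums on
    the disc.\<close>
  obtain r where r: "R < r" "r < 1" using dense R by blast
  have "summable (\<lambda>n. b n * of_real r ^ n)"
    using sums[of "of_real r"] r R by (auto simp: sums_iff)
  hence summ: "summable (\<lambda>n. cmod (b n * of_real R ^ n))"
    by (rule powser_insidea) (use r R in auto)
  define M where "M = (\<Sum>n. cmod (b n * of_real R ^ n))"
  have bound: "norm (p N z) \<le> M\<^sup>2" if "z \<in> cball 0 R" for N z
  proof -
    have "cmod (\<Sum>k<N. b k * z ^ k) \<le> (\<Sum>k<N. cmod (b k * of_real R ^ k))"
      using that R by (intro sum_norm_le) (auto simp: norm_mult norm_power intro!: mult_left_mono power_mono)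
    also have "\<dots> \<le> M"
      unfolding M_def by (intro sum_le_suminf summ) auto
    finally show ?thesis by (auto simp: p_def intro: power_mono)
  qed
  have conv: "(\<lambda>N. p N z) \<longlonglongrightarrow> (cmod (h z))\<^sup>2" if "z \<in> cball 0 R" for z
    unfolding p_def using sums[of z] that R by (intro tendsto_intros) (auto simp: sums_def)
  have const: "(\<lambda>z::complex. M\<^sup>2) integrable_on cball 0 R"
    by (intro integrable_on_const) auto
  have pi: "p N integrable_on cball 0 R" for N using p_int by blast
  have "(\<lambda>N. integral (cball 0 R) (p N)) \<longlonglongrightarrow> integral (cball 0 R) (\<lambda>z. (cmod (h z))\<^sup>2)"
    by (rule dominated_convergence(2)[OF pi const bound conv])
  moreover have "\<exists>N0. \<forall>N\<ge>N0. (\<Sum>k<K. (cmod (b k))\<^sup>2 * c k) \<le> integral (cball 0 R) (p N)"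
  \<comment> \<open>The witness is \<open>K\<close>: longer partial sums only add nonnegative
    terms.\<close>
  proof (intro exI allI impI)
    fix N assume "K \<le> N"
    thus "(\<Sum>k<K. (cmod (b k))\<^sup>2 * c k) \<le> integral (cball 0 R) (p N)"
      unfolding integral_unique[OF p_int] by (intro sum_mono2) (auto simp: c_nonneg)
  qed
  ultimately have "(\<Sum>k<K. (cmod (b k))\<^sup>2 * c k) \<le> integral (cball 0 R) (\<lambda>z. (cmod (h z))\<^sup>2)"
    by (rule LIMSEQ_le_const)
  also have "\<dots> \<le> integral (ball 0 1) (\<lambda>z. (cmod (h z))\<^sup>2)"
    by (intro integral_subset_le int dominated_convergence(1)[OF pi const bound conv]) (use R in auto)
  finally show ?thesis by (simp add: c_def)
qed

text \<open>With \<open>s k = k / Suc k\<close>, the annulus bound on the whole unit disc is at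
  least \<open>exp (-2) * pi / Suc k\<close>: the power of \<open>s k\<close> stays above
  \<open>exp (-2)\<close>, and the area factor is at least \<open>pi * (1 - s k)\<close>. This is
  the true order of the moment, whose exact value is \<open>pi / Suc k\<close>.\<close>

lemma summable_coeffs_of_square_integrable:
  fixes b :: "nat \<Rightarrow> complex"
  assumes sums: "\<And>z. cmod z < 1 \<Longrightarrow> (\<lambda>n. b n * z ^ n) sums h z"
    and int: "(\<lambda>z. (cmod (h z))\<^sup>2) integrable_on ball 0 1"
  shows "summable (\<lambda>k. (cmod (b k))\<^sup>2 / real (Suc k))"
proof -
  define A where "A = integral (ball 0 1) (\<lambda>z. (cmod (h z))\<^sup>2)"
  \<comment> \<open>Restricting the moment integral of degree \<open>2 * k\<close> to \<open>s k \<le> cmod z\<close> avoids computing it exactly.\<close>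
  define s where "s k = real k / real (Suc k)" for k
  have s: "0 \<le> s k" "s k < 1" for k by (auto simp: s_def)
  show ?thesis
  proof (rule summableI_nonneg_bounded)
    fix K
    have le: "(\<Sum>k<K. (cmod (b k))\<^sup>2 * (s k ^ (2 * k) * (pi * (R\<^sup>2 - (s k)\<^sup>2)))) \<le> A" if "0 \<le> R" "R < 1" for R
    proof -
      have "(\<Sum>k<K. (cmod (b k))\<^sup>2 * (s k ^ (2 * k) * (pi * (R\<^sup>2 - (s k)\<^sup>2))))
          \<le> (\<Sum>k<K. (cmod (b k))\<^sup>2 * integral (cball 0 R) (\<lambda>z::complex. cmod z ^ (2 * k)))"
        using that s by (intro sum_mono mult_left_mono integral_cball_cmod_power_ge) auto
      also have "\<dots> \<le> A" unfolding A_def by (rule sum_cmod_coeffs_squared_le_integral[OF sums int that])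
      finally show ?thesis .
    qed
    \<comment> \<open>For fixed \<open>K\<close> the sum is finite, so \<open>R\<close> can tend to
      1 term by term; the bound \<open>A\<close> depends on neither \<open>R\<close> nor
      \<open>K\<close>.\<close>
    have "((\<lambda>R. \<Sum>k<K. (cmod (b k))\<^sup>2 * (s k ^ (2 * k) * (pi * (R\<^sup>2 - (s k)\<^sup>2)))) \<longlongrightarrow>
        (\<Sum>k<K. (cmod (b k))\<^sup>2 * (s k ^ (2 * k) * (pi * (1\<^sup>2 - (s k)\<^sup>2))))) (at_left 1)"
      by (intro tendsto_intros)
    moreover have "eventually (\<lambda>R. (\<Sum>k<K. (cmod (b k))\<^sup>2 * (s k ^ (2 * k) * (pi * (R\<^sup>2 - (s k)\<^sup>2)))) \<le> A) (at_left 1)"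
      using eventually_at_left_real[of 0 1] by (auto elim!: eventually_mono intro!: le)
    ultimately have *: "(\<Sum>k<K. (cmod (b k))\<^sup>2 * (s k ^ (2 * k) * (pi * (1\<^sup>2 - (s k)\<^sup>2)))) \<le> A"
      by (rule tendsto_upperbound) auto
    have "exp (-2) * pi * (\<Sum>k<K. (cmod (b k))\<^sup>2 / real (Suc k))
        = (\<Sum>k<K. (cmod (b k))\<^sup>2 * (exp (-2) * (pi * (1 / real (Suc k)))))"
      by (simp add: sum_distrib_left mult_ac)
    also have "\<dots> \<le> (\<Sum>k<K. (cmod (b k))\<^sup>2 * (s k ^ (2 * k) * (pi * (1\<^sup>2 - (s k)\<^sup>2))))"
    proof (intro sum_mono mult_left_mono mult_mono)
      fix k
      show "exp (-2) \<le> s k ^ (2 * k)" unfolding s_def by (rule exp_minus2_le_power)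
      have "(s k)\<^sup>2 \<le> s k" using s[of k] by (simp add: power2_eq_square mult_left_le)
      moreover have "1 / real (Suc k) = 1 - s k" by (simp add: s_def field_simps)
      ultimately show "1 / real (Suc k) \<le> 1\<^sup>2 - (s k)\<^sup>2" by simp
    qed (use s in auto)
    also note *
    finally show "(\<Sum>k<K. (cmod (b k))\<^sup>2 / real (Suc k)) \<le> A / (exp (-2) * pi)"
      by (simp add: field_simps)
  qed auto
qed

section \<open>Cauchy-Schwarz for the tail and growth of the logarithm\<close>

lemma sum_power_over_le_ln:
  assumes "0 \<le> x" "x < (1::real)"
  shows "finite I \<Longrightarrow> (\<Sum>n\<in>I. x ^ n / real n) \<le> - ln (1 - x)"
proof -
  assume I: "finite I"
  \<comment> \<open>The term at \<open>n = 0\<close> is \<open>1 / 0 = 0\<close>, so this is the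
    usual logarithmic series starting at 1.\<close>
  have s: "(\<lambda>n. x ^ n / real n) sums (- ln (1 - x))"
    using ln_series'[of "- x"] assms sums_minus[of "\<lambda>n. - (x ^ n / real n)"] by simp
  show "(\<Sum>n\<in>I. x ^ n / real n) \<le> - ln (1 - x)"
    using sum_le_suminf[OF sums_summable[OF s] I] assms sums_unique[OF s] by simp
qed

lemma suminf_le_sqrt_Dirichlet_tail_ln:
  fixes c :: "nat \<Rightarrow> real"
  assumes c: "\<And>n. 0 \<le> c n" and r: "0 \<le> r" "r < 1"
    and Dir: "summable (\<lambda>n. real n * (c n)\<^sup>2)" and N: "N \<ge> 1"
    and summ: "summable (\<lambda>n. c n * r ^ n)"
  shows "(\<Sum>n. c n * r ^ n) \<le> (\<Sum>n<N. c n)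
           + sqrt (\<Sum>n. real (n + N) * (c (n + N))\<^sup>2) * sqrt (- ln (1 - r\<^sup>2))"
proof -
  define T where "T = (\<Sum>n. real (n + N) * (c (n + N))\<^sup>2)"
  have "r\<^sup>2 < 1" using r by (simp add: power_less_one_iff)
  have tail: "(\<Sum>n. c (n + N) * r ^ (n + N)) \<le> sqrt T * sqrt (- ln (1 - r\<^sup>2))"
  proof (rule suminf_le_const)
    show "summable (\<lambda>n. c (n + N) * r ^ (n + N))" using summ by (rule summable_ignore_initial_segment)
    fix m
    \<comment> \<open>The weight \<open>sqrt (n + N)\<close> is nonzero because
      \<open>N \<ge> 1\<close>. It splits each term so that one factor yields the Dirichlet sum and
      the other the series of \<open>- ln (1 - r\<^sup>2)\<close>.\<close>
    have "(\<Sum>n<m. c (n + N) * r ^ (n + N))\<^sup>2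
        = (\<Sum>n<m. (sqrt (real (n + N)) * c (n + N)) * (r ^ (n + N) / sqrt (real (n + N))))\<^sup>2"
      using N by (intro arg_cong[where f = "\<lambda>x. x\<^sup>2"] sum.cong) auto
    also have "\<dots> \<le> (\<Sum>n<m. (sqrt (real (n + N)) * c (n + N))\<^sup>2) * (\<Sum>n<m. (r ^ (n + N) / sqrt (real (n + N)))\<^sup>2)"
      by (rule Cauchy_Schwarz_ineq_sum)
    also have "(\<Sum>n<m. (sqrt (real (n + N)) * c (n + N))\<^sup>2) = (\<Sum>n<m. real (n + N) * (c (n + N))\<^sup>2)"
      by (simp add: power_mult_distrib)
    also have "(\<Sum>n<m. (r ^ (n + N) / sqrt (real (n + N)))\<^sup>2) = (\<Sum>n<m. (r\<^sup>2) ^ (n + N) / real (n + N))"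
      by (simp add: power_divide power_mult[symmetric] mult.commute)
    also have "\<dots> = (\<Sum>n\<in>(\<lambda>n. n + N) ` {..<m}. (r\<^sup>2) ^ n / real n)"
      by (subst sum.reindex) (auto simp: inj_on_def)
    also have "(\<Sum>n<m. real (n + N) * (c (n + N))\<^sup>2) * \<dots> \<le> T * - ln (1 - r\<^sup>2)"
      unfolding T_def
      using summable_ignore_initial_segment[OF Dir, of N] \<open>r\<^sup>2 < 1\<close>
      by (intro mult_mono sum_le_suminf sum_power_over_le_ln suminf_nonneg) (auto intro!: sum_nonneg)
    finally have "(\<Sum>n<m. c (n + N) * r ^ (n + N))\<^sup>2 \<le> T * - ln (1 - r\<^sup>2)" .
    thus "(\<Sum>n<m. c (n + N) * r ^ (n + N)) \<le> sqrt T * sqrt (- ln (1 - r\<^sup>2))"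
      unfolding real_sqrt_mult[symmetric] by (rule real_le_rsqrt)
  qed
  have "(\<Sum>n. c n * r ^ n) = (\<Sum>n. c (n + N) * r ^ (n + N)) + (\<Sum>n<N. c n * r ^ n)"
    by (rule suminf_split_initial_segment[OF summ])
  moreover have "(\<Sum>n<N. c n * r ^ n) \<le> (\<Sum>n<N. c n)"
    using c r by (intro sum_mono mult_left_le power_le_one) auto
  ultimately show ?thesis using tail by (simp add: T_def)
qed

text \<open>The left side is \<open>2 * ln (cosh (\<rho> / 2))\<close>, and
  \<open>cosh x \<le> exp x\<close> for \<open>x \<ge> 0\<close>. Under the square root of the tail
  estimate this produces the rate \<open>sqrt \<rho>\<close>.\<close>

lemma minus_ln_tanh_le:
  assumes "0 \<le> \<rho>"
  shows "- ln (1 - (tanh (\<rho> / 2))\<^sup>2) \<le> (\<rho>::real)"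
proof -
  have "cosh (\<rho> / 2) \<le> exp (\<rho> / 2)"
    using assms by (simp add: cosh_def)
  hence "(cosh (\<rho> / 2))\<^sup>2 \<le> (exp (\<rho> / 2))\<^sup>2" by (intro power_mono) auto
  also have "\<dots> = exp \<rho>" by (simp flip: exp_double)
  finally have "ln ((cosh (\<rho> / 2))\<^sup>2) \<le> \<rho>" by (subst ln_le_cancel_iff[of _ "exp \<rho>", simplified]) auto
  moreover have "1 - (tanh (\<rho> / 2))\<^sup>2 = 1 / (cosh (\<rho> / 2))\<^sup>2"
    using hyperbolic_pythagoras[of "\<rho> / 2"] cosh_real_pos[of "\<rho> / 2"]
    by (simp add: tanh_def power_divide divide_simps)
  ultimately show ?thesis by (simp add: ln_div)
qed

section \<open>Radial length bounded by the majorant series\<close>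

lemma abs_tanh_real_less_1: "\<bar>tanh x\<bar> < (1::real)"
  using tanh_real_bounds[of x] by auto

text \<open>Termwise, \<open>deriv f z\<close> is bounded in modulus by \<open>F' (cmod z)\<close>,
  where \<open>F\<close> is the power series with coefficients \<open>cmod (a n)\<close>. Along the
  geodesic this bound becomes the derivative of \<open>F (tanh (t / 2))\<close>, which integrates
  exactly.\<close>

lemma L_E_le_majorant:
  fixes a :: "nat \<Rightarrow> complex"
  assumes holo: "f holomorphic_on ball 0 1"
    and sums: "\<And>z. cmod z < 1 \<Longrightarrow> (\<lambda>n. a n * z ^ n) sums f z"
    and \<rho>: "0 \<le> \<rho>"
  shows "L_E f \<theta> \<rho> \<le> (\<Sum>n. cmod (a n) * tanh (\<rho> / 2) ^ n)"
proof -
  define F where "F r = (\<Sum>n. cmod (a n) * r ^ n)" for r :: real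
  define F' where "F' r = (\<Sum>n. diffs (\<lambda>n. cmod (a n)) n * r ^ n)" for r :: real
  have summ: "summable (\<lambda>n. cmod (a n) * x ^ n)" if x: "norm x < 1" for x :: real
  proof -
    obtain r where r: "norm x < r" "r < 1" using dense[OF x] by blast
    have "summable (\<lambda>n. a n * of_real r ^ n)"
      using sums[of "of_real r"] r by (auto simp: sums_iff)
    hence "summable (\<lambda>n. norm (a n * of_real x ^ n))"
      by (rule powser_insidea) (use r in auto)
    hence "summable (\<lambda>n. norm (cmod (a n) * x ^ n))"
      by (simp add: norm_mult norm_power abs_mult power_abs)
    thus ?thesis by (rule summable_norm_cancel)
  qed
  have F_deriv: "(F has_real_derivative F' r) (at r)" if "norm r < 1" for r
    unfolding F_def[abs_def] F'_def by (rule termdiffs_strong'[OF summ that])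
  have F'_summ: "summable (\<lambda>n. diffs (\<lambda>n. cmod (a n)) n * r ^ n)" if "norm r < 1" for r :: real
    by (rule termdiff_converges[OF that summ])
  have deriv_le: "cmod (deriv f z) \<le> F' (cmod z)" if z: "cmod z < 1" for z
  proof -
    have "(f has_field_derivative deriv f z) (at z)"
      by (rule holomorphic_derivI[OF holo]) (use z in auto)
    hence s: "(\<lambda>n. diffs a n * z ^ n) sums deriv f z"
      using termdiffs_sums_strong[of 1 a f, OF sums] z by blast
    have eq: "cmod (diffs a n * z ^ n) = diffs (\<lambda>n. cmod (a n)) n * cmod z ^ n" for n
      by (simp add: diffs_def norm_mult norm_power del: of_nat_Suc)
    have "cmod (\<Sum>n. diffs a n * z ^ n) \<le> (\<Sum>n. cmod (diffs a n * z ^ n))"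
      using F'_summ[of "cmod z"] z by (intro summable_norm) (simp add: eq)
    thus ?thesis using s by (simp add: sums_iff eq F'_def)
  qed
  \<comment> \<open>This derivative is the reciprocal of \<open>hyp_density\<close> at
    \<open>radial_geod \<theta> t\<close>: the geodesic is parametrized by hyperbolic
    length.\<close>
  have tanh_deriv: "((\<lambda>t. tanh (t / 2)) has_real_derivative (1 - (tanh (t / 2))\<^sup>2) / 2) (at t)" for t :: real
    by (auto intro!: derivative_eq_intros)
  have F_int: "((\<lambda>t. F' (tanh (t / 2)) * ((1 - (tanh (t / 2))\<^sup>2) / 2)) has_integral
        (F (tanh (\<rho> / 2)) - F (tanh (0 / 2)))) {0..\<rho>}"
  proof (rule fundamental_theorem_of_calculus[OF \<rho>])
    fix t assume "t \<in> {0..\<rho>}"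
    have "((\<lambda>t. F (tanh (t / 2))) has_real_derivative F' (tanh (t / 2)) * ((1 - (tanh (t / 2))\<^sup>2) / 2)) (at t)"
      using abs_tanh_real_less_1 [of "t / 2"]
      by (intro DERIV_chain2[OF F_deriv tanh_deriv]) auto
    thus "((\<lambda>t. F (tanh (t / 2))) has_vector_derivative F' (tanh (t / 2)) * ((1 - (tanh (t / 2))\<^sup>2) / 2)) (at t within {0..\<rho>})"
      by (simp add: has_real_derivative_iff_has_vector_derivative has_vector_derivative_at_within)
  qed
  have geod: "cmod (radial_geod \<theta> t) = \<bar>tanh (t / 2)\<bar>" for t
    by (simp add: radial_geod_def norm_mult)
  have geod_lt: "cmod (radial_geod \<theta> t) < 1" for t
    unfolding geod by (rule abs_tanh_real_less_1)
  have norm_HE_eq: "norm_HE f (radial_geod \<theta> t) = cmod (deriv f (radial_geod \<theta> t)) * ((1 - (tanh (t / 2))\<^sup>2) / 2)" for t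
    by (simp add: norm_HE_def hyp_density_def geod)
  have "L_E f \<theta> \<rho> \<le> F (tanh (\<rho> / 2)) - F (tanh (0 / 2))"
    unfolding L_E_def
  proof (rule has_integral_le[OF integrable_integral F_int])
    have "continuous_on {0..\<rho>} (\<lambda>t. deriv f (radial_geod \<theta> t))"
    proof (rule continuous_on_compose2[of "ball 0 1" "deriv f"])
      show "continuous_on (ball 0 1) (deriv f)"
        by (intro holomorphic_on_imp_continuous_on holomorphic_deriv holo) auto
      show "continuous_on {0..\<rho>} (radial_geod \<theta>)"
        unfolding radial_geod_def[abs_def] by (intro continuous_intros) auto
    qed (use geod_lt in auto)
    thus "(\<lambda>t. norm_HE f (radial_geod \<theta> t)) integrable_on {0..\<rho>}"
      unfolding norm_HE_eq by (intro integrable_continuous_interval continuous_intros) auto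
  next
    fix t assume t: "t \<in> {0..\<rho>}"
    have "(tanh (t / 2))\<^sup>2 < 1"
      using abs_tanh_real_less_1[of "t / 2"] by (simp add: abs_square_less_1)
    thus "norm_HE f (radial_geod \<theta> t) \<le> F' (tanh (t / 2)) * ((1 - (tanh (t / 2))\<^sup>2) / 2)"
      unfolding norm_HE_eq using deriv_le[OF geod_lt, of t] t
      by (intro mult_right_mono) (auto simp: geod)
  qed
  \<comment> \<open>The dropped term is \<open>F 0 = cmod (a 0)\<close>, which is
    nonnegative.\<close>
  also have "\<dots> \<le> F (tanh (\<rho> / 2))"
    by (simp add: F_def)
  finally show ?thesis by (simp add: F_def)
qed

lemma L_E_nonneg: "0 \<le> L_E f \<theta> \<rho>"
proof -
  have "0 \<le> norm_HE f (radial_geod \<theta> t)" for t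
    using abs_tanh_real_less_1[of "t / 2"] abs_square_less_1[of "tanh (t / 2)"]
    by (simp add: norm_HE_def hyp_density_def radial_geod_def norm_mult)
  thus ?thesis
    \<comment> \<open>If the integrand is not integrable, \<open>integral\<close> takes the default
      value 0.\<close>
    unfolding L_E_def by (cases "(\<lambda>t. norm_HE f (radial_geod \<theta> t)) integrable_on {0..\<rho>}")
      (auto intro: integral_nonneg simp: not_integrable_integral)
qed

section \<open>The little-o estimate\<close>

theorem theorem3p1:
  fixes f :: "complex \<Rightarrow> complex" and \<theta> :: real
  assumes "f holomorphic_on ball 0 1"
    and "finite_euclid_area f"
  shows "(\<lambda>\<rho>0. L_E f \<theta> \<rho>0) \<in> o[at_top](\<lambda>\<rho>0. sqrt \<rho>0)"
proof -
  define a where "a n = (deriv ^^ n) f 0 / fact n" for n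
  have sums: "(\<lambda>n. a n * z ^ n) sums f z" if "cmod z < 1" for z
    using holomorphic_power_series[OF assms(1), of z] that by (simp add: a_def)
  have deriv_sums: "(\<lambda>n. diffs a n * z ^ n) sums deriv f z" if "cmod z < 1" for z
    using that by (intro termdiffs_sums_strong[of 1 a f, OF sums] holomorphic_derivI[OF assms(1)]) auto
  define c where "c n = cmod (a n)" for n
  have "summable (\<lambda>k. (cmod (diffs a k))\<^sup>2 / real (Suc k))"
    using assms(2) deriv_sums unfolding finite_euclid_area_def
    by (intro summable_coeffs_of_square_integrable)
  \<comment> \<open>The coefficient of the derivative is
    \<open>diffs a k = Suc k * a (Suc k)\<close>; dividing its squared modulus by
    \<open>Suc k\<close> leaves one factor \<open>Suc k\<close>.\<close>
  also have "(\<lambda>k. (cmod (diffs a k))\<^sup>2 / real (Suc k)) = (\<lambda>k. real (Suc k) * (c (Suc k))\<^sup>2)"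
    by (auto simp: diffs_def c_def norm_mult power_mult_distrib power2_eq_square simp del: of_nat_Suc)
  finally have Dir: "summable (\<lambda>n. real n * (c n)\<^sup>2)"
    by (subst (asm) summable_Suc_iff)
  show ?thesis
  proof (rule landau_o.smallI)
    fix e :: real assume e: "e > 0"
    \<comment> \<open>The error \<open>e\<close> is shared equally: a Dirichlet tail below
      \<open>(e / 2)\<^sup>2\<close> gives \<open>sqrt T \<le> e / 2\<close>, and the other half
      absorbs the initial sum \<open>C\<close>.\<close>
    obtain N0 where N0: "\<And>n. n \<ge> N0 \<Longrightarrow> norm (\<Sum>i. real (i + n) * (c (i + n))\<^sup>2) < (e / 2)\<^sup>2"
      using suminf_exist_split[of "(e / 2)\<^sup>2", OF _ Dir] e by auto
    define N where "N = max 1 N0"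
    define T where "T = (\<Sum>n. real (n + N) * (c (n + N))\<^sup>2)"
    have "T < (e / 2)\<^sup>2" using N0[of N] by (simp add: N_def T_def)
    hence T: "sqrt T \<le> e / 2" using e by (intro real_le_lsqrt) auto
    define C where "C = (\<Sum>n<N. c n)"
    \<comment> \<open>Beyond this threshold \<open>C \<le> e / 2 * sqrt \<rho>\<close>. It is fixed
      after \<open>N\<close>, on which \<open>C\<close> depends.\<close>
    have "eventually (\<lambda>\<rho>. (2 * C / e)\<^sup>2 \<le> \<rho> \<and> 0 \<le> \<rho>) at_top"
      by (intro eventually_conj eventually_ge_at_top)
    thus "eventually (\<lambda>\<rho>. norm (L_E f \<theta> \<rho>) \<le> e * norm (sqrt \<rho>)) at_top"
    proof eventually_elim
      case (elim \<rho>)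
      define r where "r = tanh (\<rho> / 2)"
      have r: "0 \<le> r" "r < 1" using elim by (auto simp: r_def tanh_real_lt_1)
      have "summable (\<lambda>n. c n * r ^ n)"
      proof -
        obtain x where x: "r < x" "x < 1" using dense[OF r(2)] by blast
        have "summable (\<lambda>n. a n * of_real x ^ n)"
          using sums[of "of_real x"] r x by (auto simp: sums_iff)
        hence "summable (\<lambda>n. norm (a n * of_real r ^ n))"
          by (rule powser_insidea) (use r x in auto)
        thus ?thesis using r by (simp add: c_def norm_mult norm_power)
      qed
      hence "(\<Sum>n. c n * r ^ n) \<le> C + sqrt T * sqrt (- ln (1 - r\<^sup>2))"
        unfolding C_def T_def by (intro suminf_le_sqrt_Dirichlet_tail_ln r Dir) (auto simp: c_def N_def)
      moreover have "L_E f \<theta> \<rho> \<le> (\<Sum>n. c n * r ^ n)"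
        unfolding c_def r_def using elim by (intro L_E_le_majorant assms(1) sums) auto
      moreover have "sqrt T * sqrt (- ln (1 - r\<^sup>2)) \<le> e / 2 * sqrt \<rho>"
      proof (rule mult_mono)
        show "sqrt (- ln (1 - r\<^sup>2)) \<le> sqrt \<rho>"
          unfolding r_def using elim by (intro real_sqrt_le_mono minus_ln_tanh_le) auto
        have "r\<^sup>2 < 1" using r by (simp add: power_less_one_iff)
        thus "0 \<le> sqrt (- ln (1 - r\<^sup>2))" by simp
      qed (use T e in auto)
      moreover have "C \<le> e / 2 * sqrt \<rho>"
      proof -
        have "2 * C / e \<le> sqrt \<rho>" using elim by (intro real_le_rsqrt) auto
        thus ?thesis using e by (simp add: field_simps)
      qed
      ultimately have "L_E f \<theta> \<rho> \<le> e * sqrt \<rho>" by linarith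
      thus ?case using L_E_nonneg[of f \<theta> \<rho>] elim by simp
    qed
  qed
qed

end
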